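(* Suppose $S$ and $T$ are inverse semigroups such that $T$ is a monoid. Then the following are equivalent: (1) there exists an idempotent $e\in E(S)$ such that $S=SeS$ and $T\cong eSe$; (2) $S$ and $T$ are strongly Morita equivalent; (3) the categories $S_E$ and $T_E$ are equivalent. Consequently, if $S$ and $T$ are strongly Morita equivalent with $T$ a monoid, then $S$ is an enlargement of (an isomorphic copy of) $T$. In particular, if $S$ and $T$ are inverse monoids, then $S$ is strongly Morita equivalent to $T$ if and only if there exist $e\in E(S)$ and $f\in E(T)$ such that $S=SeS$, $eSe\cong T$, $T=TfT$ and $fTf\cong S$.
   Context: An inverse semigroup is a semigroup $S$ such that for each $s\in S$ there is a unique $s^*\in S$ with $ss^*s=s$ and $s^*ss^*=s^*$; $E(S)$ is its set of idempotents. $S$ is an enlargement of an inverse subsemigroup $T$ if $STS=S$ and $TST=T$. A Morita context is a 5-tuple $(S,T,X,\langle\ ,\ \rangle,[\ ,\ ])$ where $S,T$ are inverse semigroups, $X$ is a set with a left action of $S$ and a right action of $T$ that commute, and $\langle\ ,\ \rangle\colon X\times X\to S$, $[\ ,\ ]\colon X\times X\to T$ are surjective functions such that for all $x,y,z\in X$, $s\in S$, $t\in T$: (1) $\langle sx,y\rangle=s\langle x,y\rangle$; (2) $\langle y,x\rangle=\langle x,y\rangle^*$; (3) $\langle x,x\rangle x=x$; (4) $[x,yt]=[x,y]t$; (5) $[y,x]=[x,y]^*$; (6) $x[x,x]=x$; (7) $\langle x,y\rangle z=x[y,z]$. $S$ and $T$ are strongly Morita equivalent if such a Morita context exists. $S_E$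 is the category with object set $E(S)$ and arrows $(f,s,e)\colon e\to f$ with $e,f\in E(S)$, $s\in fSe$; composition is $(f,s,e)(e,s',d)=(f,ss',d)$ and the identity at $e$ is $(e,e,e)$. *)

theory Defs
  imports "HOL-Algebra.Coset"
begin

section \<open>Inverse semigroups\<close>

text \<open>
  Semigroups are carried by the record type of HOL-Algebra monoids, so that set products, restricted
  structures and isomorphisms can be taken from the library. For a structure that is only assumed to
  be a semigroup the field \<open>one\<close> has no meaning, and nothing below depends on it; in particular
  \<open>hom\<close>, \<open>iso\<close> and \<open>\<cong>\<close> do not mention \<open>one\<close>, so they are the semigroup notions.
\<close>

locale inverse_semigroup =
  fixes S :: "('a, 'm) monoid_scheme" (structure)
  assumes m_closed [simp, intro]: "\<lbrakk>x \<in> carrier S; y \<in> carrier S\<rbrakk> \<Longrightarrow> x \<otimes> y \<in> carrier S"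
    and m_assoc: "\<lbrakk>x \<in> carrier S; y \<in> carrier S; z \<in> carrier S\<rbrakk> \<Longrightarrow> (x \<otimes> y) \<otimes> z = x \<otimes> (y \<otimes> z)"
    and ex1_star: "s \<in> carrier S \<Longrightarrow> \<exists>!t. t \<in> carrier S \<and> s \<otimes> t \<otimes> s = s \<and> t \<otimes> s \<otimes> t = t"

definition star :: "('a, 'm) monoid_scheme \<Rightarrow> 'a \<Rightarrow> 'a" where
  "star S s = (THE t. t \<in> carrier S \<and> s \<otimes>\<^bsub>S\<^esub> t \<otimes>\<^bsub>S\<^esub> s = s \<and> t \<otimes>\<^bsub>S\<^esub> s \<otimes>\<^bsub>S\<^esub> t = t)"

definition idempotents :: "('a, 'm) monoid_scheme \<Rightarrow> 'a set" where
  "idempotents S = {e \<in> carrier S. e \<otimes>\<^bsub>S\<^esub> e = e}"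

definition local_monoid :: "('a, 'm) monoid_scheme \<Rightarrow> 'a \<Rightarrow> ('a, 'm) monoid_scheme" where
  "local_monoid S e = S\<lparr>carrier := {e} <#>\<^bsub>S\<^esub> carrier S <#>\<^bsub>S\<^esub> {e}, one := e\<rparr>"

definition inverse_subsemigroup :: "'a set \<Rightarrow> ('a, 'm) monoid_scheme \<Rightarrow> bool" where
  "inverse_subsemigroup U S \<longleftrightarrow>
     U \<subseteq> carrier S \<and> (\<forall>x\<in>U. \<forall>y\<in>U. x \<otimes>\<^bsub>S\<^esub> y \<in> U) \<and> (\<forall>x\<in>U. star S x \<in> U)"

definition enlargement :: "('a, 'm) monoid_scheme \<Rightarrow> 'a set \<Rightarrow> bool" where
  "enlargement S U \<longleftrightarrow>
     inverse_subsemigroup U S \<and>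
     carrier S <#>\<^bsub>S\<^esub> U <#>\<^bsub>S\<^esub> carrier S = carrier S \<and>
     U <#>\<^bsub>S\<^esub> carrier S <#>\<^bsub>S\<^esub> U = U"


section \<open>Strong Morita equivalence\<close>

locale morita_context =
  S: inverse_semigroup S + T: inverse_semigroup T
  for S :: "('a, 'm) monoid_scheme" and T :: "('b, 'n) monoid_scheme" +
  fixes X :: "'x set"
    and lact :: "'a \<Rightarrow> 'x \<Rightarrow> 'x"
    and ract :: "'x \<Rightarrow> 'b \<Rightarrow> 'x"
    and lip :: "'x \<Rightarrow> 'x \<Rightarrow> 'a"
    and rip :: "'x \<Rightarrow> 'x \<Rightarrow> 'b"
  assumes lact_closed: "\<lbrakk>s \<in> carrier S; x \<in> X\<rbrakk> \<Longrightarrow> lact s x \<in> X"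
    and lact_mult:
      "\<lbrakk>s \<in> carrier S; s' \<in> carrier S; x \<in> X\<rbrakk> \<Longrightarrow> lact (s \<otimes>\<^bsub>S\<^esub> s') x = lact s (lact s' x)"
    and ract_closed: "\<lbrakk>x \<in> X; t \<in> carrier T\<rbrakk> \<Longrightarrow> ract x t \<in> X"
    and ract_mult:
      "\<lbrakk>x \<in> X; t \<in> carrier T; t' \<in> carrier T\<rbrakk> \<Longrightarrow> ract x (t \<otimes>\<^bsub>T\<^esub> t') = ract (ract x t) t'"
    and act_commute:
      "\<lbrakk>s \<in> carrier S; x \<in> X; t \<in> carrier T\<rbrakk> \<Longrightarrow> ract (lact s x) t = lact s (ract x t)"
    and lip_surj: "(\<lambda>(x, y). lip x y) ` (X \<times> X) = carrier S"
    and rip_surj: "(\<lambda>(x, y). rip x y) ` (X \<times> X) = carrier T"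
    and lip_lact: "\<lbrakk>s \<in> carrier S; x \<in> X; y \<in> X\<rbrakk> \<Longrightarrow> lip (lact s x) y = s \<otimes>\<^bsub>S\<^esub> lip x y"
    and lip_star: "\<lbrakk>x \<in> X; y \<in> X\<rbrakk> \<Longrightarrow> lip y x = star S (lip x y)"
    and lip_self: "x \<in> X \<Longrightarrow> lact (lip x x) x = x"
    and rip_ract: "\<lbrakk>x \<in> X; y \<in> X; t \<in> carrier T\<rbrakk> \<Longrightarrow> rip x (ract y t) = rip x y \<otimes>\<^bsub>T\<^esub> t"
    and rip_star: "\<lbrakk>x \<in> X; y \<in> X\<rbrakk> \<Longrightarrow> rip y x = star T (rip x y)"
    and rip_self: "x \<in> X \<Longrightarrow> ract x (rip x x) = x"
    and lip_rip: "\<lbrakk>x \<in> X; y \<in> X; z \<in> X\<rbrakk> \<Longrightarrow> lact (lip x y) z = ract x (rip y z)"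

text \<open>
  A definition in HOL cannot quantify over the type of the set \<open>X\<close>. Subsets of \<open>'a \<times> 'b\<close> suffice:
  lemma \<open>strongly_morita_equivalentI\<close> below turns a Morita context on a set of any type into one on
  such a subset.
\<close>

definition strongly_morita_equivalent ::
    "('a, 'm) monoid_scheme \<Rightarrow> ('b, 'n) monoid_scheme \<Rightarrow> bool" where
  "strongly_morita_equivalent S T \<longleftrightarrow>
     (\<exists>(X :: ('a \<times> 'b) set) lact ract lip rip. morita_context S T X lact ract lip rip)"

lemma morita_context_transfer:
  assumes "morita_context S T X lact ract lip rip" and inj: "inj_on i X"
  shows "morita_context S T (i ` X)
           (\<lambda>s p. i (lact s (inv_into X i p))) (\<lambda>p t. i (ract (inv_into X i p) t))
           (\<lambda>p q. lip (inv_into X i p) (inv_into X i q))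
           (\<lambda>p q. rip (inv_into X i p) (inv_into X i q))"
proof -
  interpret morita_context S T X lact ract lip rip by fact
  have lip_closed: "lip x y \<in> carrier S" if "x \<in> X" "y \<in> X" for x y
    using lip_surj that by force
  have rip_closed: "rip x y \<in> carrier T" if "x \<in> X" "y \<in> X" for x y
    using rip_surj that by force
  note [simp] = inv_into_f_f[OF inj] lact_closed ract_closed lip_closed rip_closed
  show ?thesis
  proof (unfold_locales, goal_cases)
    case 6
    have "(\<lambda>(p, q). lip (inv_into X i p) (inv_into X i q)) ` (i ` X \<times> i ` X)
        = (\<lambda>(x, y). lip x y) ` (X \<times> X)"
      by (force simp: image_iff)
    then show ?case by (simp add: lip_surj)
  next
    case 7
    have "(\<lambda>(p, q). rip (inv_into X i p) (inv_into X i q)) ` (i ` X \<times> i ` X)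
        = (\<lambda>(x, y). rip x y) ` (X \<times> X)"
      by (force simp: image_iff)
    then show ?case by (simp add: rip_surj)
  qed (auto simp: lact_mult ract_mult act_commute lip_lact lip_self rip_ract rip_self lip_rip
       intro: lip_star rip_star)
qed

lemma strongly_morita_equivalentI:
  assumes "morita_context S T X lact ract lip rip"
  shows "strongly_morita_equivalent S T"
proof -
  interpret morita_context S T X lact ract lip rip by fact
  define c where "c e = (SOME y. y \<in> X \<and> lip y y = e)" for e
  define i where "i x = (lip x x, rip (c (lip x x)) x)" for x
  have c: "c (lip x x) \<in> X \<and> lip (c (lip x x)) (c (lip x x)) = lip x x" if "x \<in> X" for x
    unfolding c_def by (rule someI[of _ x]) (simp add: that)
  have "x = ract (c (lip x x)) (rip (c (lip x x)) x)" if "x \<in> X" for x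
    using c[OF that] lip_self[OF that] lip_rip[of "c (lip x x)" "c (lip x x)" x] that by simp
  then have "inj_on i X"
    unfolding inj_on_def i_def by (metis prod.inject)
  from morita_context_transfer[OF assms this] show ?thesis
    unfolding strongly_morita_equivalent_def by blast
qed


section \<open>Equivalence of categories\<close>

record ('o, 'r) cat =
  obj :: "'o set"
  arr :: "'r set"
  src :: "'r \<Rightarrow> 'o"
  tgt :: "'r \<Rightarrow> 'o"
  ident :: "'o \<Rightarrow> 'r"
  arr_comp :: "'r \<Rightarrow> 'r \<Rightarrow> 'r"

definition hom_set :: "('o, 'r) cat \<Rightarrow> 'o \<Rightarrow> 'o \<Rightarrow> 'r set" where
  "hom_set C x y = {a \<in> arr C. src C a = x \<and> tgt C a = y}"

locale category =
  fixes C :: "('o, 'r) cat"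
  assumes src_obj: "a \<in> arr C \<Longrightarrow> src C a \<in> obj C"
    and tgt_obj: "a \<in> arr C \<Longrightarrow> tgt C a \<in> obj C"
    and ident_hom: "x \<in> obj C \<Longrightarrow> ident C x \<in> hom_set C x x"
    and compose_hom:
      "\<lbrakk>b \<in> hom_set C y z; a \<in> hom_set C x y\<rbrakk> \<Longrightarrow> arr_comp C b a \<in> hom_set C x z"
    and compose_assoc:
      "\<lbrakk>c \<in> hom_set C z w; b \<in> hom_set C y z; a \<in> hom_set C x y\<rbrakk> \<Longrightarrow>
         arr_comp C (arr_comp C c b) a = arr_comp C c (arr_comp C b a)"
    and compose_ident_right: "a \<in> hom_set C x y \<Longrightarrow> arr_comp C a (ident C x) = a"
    and compose_ident_left: "a \<in> hom_set C x y \<Longrightarrow> arr_comp C (ident C y) a = a"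

locale cat_functor = C: category C + D: category D
  for C :: "('o, 'r) cat" and D :: "('p, 'q) cat" +
  fixes Fo :: "'o \<Rightarrow> 'p" and Fa :: "'r \<Rightarrow> 'q"
  assumes map_obj: "x \<in> obj C \<Longrightarrow> Fo x \<in> obj D"
    and map_hom: "a \<in> hom_set C x y \<Longrightarrow> Fa a \<in> hom_set D (Fo x) (Fo y)"
    and map_ident: "x \<in> obj C \<Longrightarrow> Fa (ident C x) = ident D (Fo x)"
    and map_compose:
      "\<lbrakk>b \<in> hom_set C y z; a \<in> hom_set C x y\<rbrakk> \<Longrightarrow> Fa (arr_comp C b a) = arr_comp D (Fa b) (Fa a)"

definition isomorphisms :: "('o, 'r) cat \<Rightarrow> 'o \<Rightarrow> 'o \<Rightarrow> 'r set" where
  "isomorphisms C x y = {a \<in> hom_set C x y.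
     \<exists>b \<in> hom_set C y x. arr_comp C b a = ident C x \<and> arr_comp C a b = ident C y}"

locale natural_iso = F: cat_functor C D Fo Fa + G: cat_functor C D Go Ga
  for C :: "('o, 'r) cat" and D :: "('p, 'q) cat" and Fo Fa Go Ga +
  fixes \<eta> :: "'o \<Rightarrow> 'q"
  assumes component_iso: "x \<in> obj C \<Longrightarrow> \<eta> x \<in> isomorphisms D (Fo x) (Go x)"
    and naturality:
      "a \<in> hom_set C x y \<Longrightarrow> arr_comp D (\<eta> y) (Fa a) = arr_comp D (Ga a) (\<eta> x)"

definition equivalent_categories :: "('o, 'r) cat \<Rightarrow> ('p, 'q) cat \<Rightarrow> bool" where
  "equivalent_categories C D \<longleftrightarrow>
     (\<exists>Fo Fa Go Ga \<eta> \<epsilon>.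
        cat_functor C D Fo Fa \<and> cat_functor D C Go Ga \<and>
        natural_iso C C id id (Go \<circ> Fo) (Ga \<circ> Fa) \<eta> \<and>
        natural_iso D D (Fo \<circ> Go) (Fa \<circ> Ga) id id \<epsilon>)"

text \<open>The category \<open>S\<^sub>E\<close>: a triple \<open>(f, s, e)\<close> is an arrow from \<open>e\<close> to \<open>f\<close>.\<close>

definition idem_cat :: "('a, 'm) monoid_scheme \<Rightarrow> ('a, 'a \<times> 'a \<times> 'a) cat" where
  "idem_cat S = \<lparr>
     obj = idempotents S,
     arr = {(f, s, e). f \<in> idempotents S \<and> e \<in> idempotents S \<and>
                       s \<in> {f} <#>\<^bsub>S\<^esub> carrier S <#>\<^bsub>S\<^esub> {e}},
     src = (\<lambda>(f, s, e). e),
     tgt = (\<lambda>(f, s, e). f),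
     ident = (\<lambda>e. (e, e, e)),
     arr_comp = (\<lambda>(f, s, e) (e', s', d). (f, s \<otimes>\<^bsub>S\<^esub> s', d))\<rparr>"

lemma (in inverse_semigroup) category_idem_cat: "category (idem_cat S)"
proof -
  have corner: "s \<in> {f} <#> carrier S <#> {e} \<longleftrightarrow> s \<in> carrier S \<and> f \<otimes> s = s \<and> s \<otimes> e = s"
    if "f \<in> idempotents S" "e \<in> idempotents S" for s f e
    using that unfolding set_mult_def idempotents_def
    by (auto simp: m_assoc) (metis m_assoc m_closed)+
  show ?thesis
    by unfold_locales
      (auto simp: idem_cat_def hom_set_def corner m_assoc, auto simp: idempotents_def m_assoc[symmetric], metis m_assoc)
qed

end

theory Submission
  imports Defs
begin

text \<open>
  If \<open>T \<cong> eSe\<close> with \<open>S = SeS\<close>, the set \<open>Se\<close> with \<open>\<langle>x, y\<rangle> = xy\<^sup>*\<close> and \<open>[x, y] = x\<^sup>*y\<close> is a Morita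
  context, and the inclusion of \<open>eSe\<close> induces a fully faithful functor on idempotent categories that is
  essentially surjective, because every idempotent of \<open>S = SeS\<close> has the form \<open>xx\<^sup>*\<close> with \<open>x\<^sup>*x \<le> e\<close>.
  Conversely, in a Morita context over a monoid \<open>T\<close> some \<open>x\<close> satisfies \<open>[x, x] = 1\<close>; then
  \<open>e = \<langle>x, x\<rangle>\<close> works, with the isomorphism \<open>t \<mapsto> \<langle>xt, x\<rangle>\<close>. Given an equivalence \<open>G\<close> from \<open>T\<^sub>E\<close> to \<open>S\<^sub>E\<close>
  take \<open>e = G(1)\<close>: the local monoid at \<open>e\<close> is its endomorphism monoid, and \<open>SeS = S\<close> holds since every
  object of \<open>T\<^sub>E\<close> is a retract of \<open>1\<close>.
\<close>

section \<open>Inverse semigroups\<close>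

text \<open>Closure of \<open>G\<close> puts \<open>?k x \<otimes> ?k y\<close> in the domain where
  \<open>?k\<close> undoes \<open>h\<close>, and this makes the inverse bijection multiplicative.
  The form suits semigroups, for which \<open>one\<close> has no meaning.\<close>

lemma is_iso_sym:
  assumes closed: "\<And>x y. \<lbrakk>x \<in> carrier G; y \<in> carrier G\<rbrakk> \<Longrightarrow> x \<otimes>\<^bsub>G\<^esub> y \<in> carrier G"
    and "G \<cong> H"
  shows "H \<cong> G"
proof -
  obtain h where h: "h \<in> hom G H" and bij: "bij_betw h (carrier G) (carrier H)"
    using assms(2) by (auto simp: is_iso_def iso_def)
  let ?k = "inv_into (carrier G) h"
  have k: "?k x \<in> carrier G" "h (?k x) = x" if "x \<in> carrier H" for x
    using that bij by (auto simp: bij_betw_def inv_into_into f_inv_into_f)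
  have "?k \<in> hom H G"
  proof (rule homI)
    fix x y assume xy: "x \<in> carrier H" "y \<in> carrier H"
    have "?k (h (?k x \<otimes>\<^bsub>G\<^esub> ?k y)) = ?k x \<otimes>\<^bsub>G\<^esub> ?k y"
      using xy k closed bij by (simp add: bij_betw_def)
    then show "?k (x \<otimes>\<^bsub>H\<^esub> y) = ?k x \<otimes>\<^bsub>G\<^esub> ?k y"
      using xy k by (simp add: hom_mult[OF h])
  qed (rule k)
  then show ?thesis
    using bij_betw_inv_into[OF bij] by (auto simp: is_iso_def iso_def)
qed

context inverse_semigroup
begin

section \<open>Calculus of \<open>star\<close> and commuting idempotents\<close>

lemma star_spec:
  assumes "s \<in> carrier S"
  shows "star S s \<in> carrier S \<and> s \<otimes> star S s \<otimes> s = s \<and> star S s \<otimes> s \<otimes> star S s = star S s"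
  unfolding star_def by (rule theI'[OF ex1_star[OF assms]])

lemma star_closed [simp, intro]: "s \<in> carrier S \<Longrightarrow> star S s \<in> carrier S"
  and mult_star_mult: "s \<in> carrier S \<Longrightarrow> s \<otimes> (star S s \<otimes> s) = s"
  and star_mult_star: "s \<in> carrier S \<Longrightarrow> star S s \<otimes> (s \<otimes> star S s) = star S s"
  using star_spec[of s] by (auto simp: m_assoc)

lemma star_unique:
  assumes "s \<in> carrier S" "t \<in> carrier S" "s \<otimes> (t \<otimes> s) = s" "t \<otimes> (s \<otimes> t) = t"
  shows "star S s = t"
  unfolding star_def by (rule the1_equality[OF ex1_star[OF assms(1)]]) (use assms in \<open>simp add: m_assoc\<close>)

lemma star_star [simp]: "s \<in> carrier S \<Longrightarrow> star S (star S s) = s"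
  by (intro star_unique) (auto simp: mult_star_mult star_mult_star)

lemma idemI: "\<lbrakk>e \<in> carrier S; e \<otimes> e = e\<rbrakk> \<Longrightarrow> e \<in> idempotents S"
  by (simp add: idempotents_def)

lemma idem_closed [simp]: "e \<in> idempotents S \<Longrightarrow> e \<in> carrier S"
  and idem_idem [simp]: "e \<in> idempotents S \<Longrightarrow> e \<otimes> e = e"
  by (auto simp: idempotents_def)

lemma idem_left [simp]:
  "\<lbrakk>e \<in> idempotents S; x \<in> carrier S\<rbrakk> \<Longrightarrow> e \<otimes> (e \<otimes> x) = e \<otimes> x"
  by (simp flip: m_assoc)

lemma star_idem [simp]: "e \<in> idempotents S \<Longrightarrow> star S e = e"
  by (intro star_unique) auto

text \<open>If \<open>x\<close> is the inverse of \<open>e \<otimes> f\<close>, then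
  \<open>f \<otimes> x \<otimes> e\<close> is an inverse too, so uniqueness gives
  \<open>x = f \<otimes> x \<otimes> e\<close>. In this form \<open>x\<close> is seen to be
  idempotent, hence its own inverse, hence equal to \<open>e \<otimes> f\<close>.\<close>

lemma idem_mult_idem:
  assumes e: "e \<in> idempotents S" and f: "f \<in> idempotents S"
  shows "e \<otimes> f \<in> idempotents S"
proof -
  define x where "x = star S (e \<otimes> f)"
  have [simp]: "e \<in> carrier S" "f \<in> carrier S" "x \<in> carrier S"
    using e f by (auto simp: x_def)
  have x1: "e \<otimes> (f \<otimes> (x \<otimes> (e \<otimes> f))) = e \<otimes> f"
    using mult_star_mult[of "e \<otimes> f"] by (simp add: x_def m_assoc)
  have x2: "x \<otimes> (e \<otimes> (f \<otimes> x)) = x"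
    using star_mult_star[of "e \<otimes> f"] by (simp add: x_def m_assoc)
  have x3: "x \<otimes> (e \<otimes> (f \<otimes> (x \<otimes> e))) = x \<otimes> e"
    using arg_cong[OF x2, of "\<lambda>u. u \<otimes> e"] by (simp add: m_assoc)
  have x_eq: "x = f \<otimes> (x \<otimes> e)"
    unfolding x_def
    by (rule star_unique) (use e f x1 x3 in \<open>auto simp: m_assoc simp flip: x_def\<close>)
  have "x \<otimes> x = (f \<otimes> (x \<otimes> e)) \<otimes> (f \<otimes> (x \<otimes> e))"
    by (rule arg_cong2[OF x_eq x_eq])
  also have "\<dots> = f \<otimes> (x \<otimes> e)"
    using e f by (simp add: m_assoc x3)
  also have "\<dots> = x"
    by (rule x_eq[symmetric])
  finally have "x \<in> idempotents S"
    by (intro idemI) auto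
  have "x = star S x"
    by (rule star_idem[OF \<open>x \<in> idempotents S\<close>, symmetric])
  also have "\<dots> = e \<otimes> f"
    unfolding x_def by (rule star_star) simp
  finally have "x = e \<otimes> f" .
  with \<open>x \<in> idempotents S\<close> show ?thesis by simp
qed

text \<open>Both products are idempotent, which makes \<open>f \<otimes> e\<close> an inverse of
  \<open>e \<otimes> f\<close>; but an idempotent is its own inverse.\<close>

lemma idem_commute:
  assumes e: "e \<in> idempotents S" and f: "f \<in> idempotents S"
  shows "e \<otimes> f = f \<otimes> e"
proof -
  note ef = idem_idem[OF idem_mult_idem[OF e f]] and fe = idem_idem[OF idem_mult_idem[OF f e]]
  have "star S (e \<otimes> f) = f \<otimes> e"
    by (rule star_unique) (use e f ef fe in \<open>auto simp: m_assoc\<close>)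
  then show ?thesis
    using star_idem[OF idem_mult_idem[OF e f]] by simp
qed

lemma star_mult_idem [simp]: "s \<in> carrier S \<Longrightarrow> star S s \<otimes> s \<in> idempotents S"
  and mult_star_idem [simp]: "s \<in> carrier S \<Longrightarrow> s \<otimes> star S s \<in> idempotents S"
  by (auto intro!: idemI simp: m_assoc mult_star_mult star_mult_star)

text \<open>The idempotents \<open>t \<otimes> star S t\<close> and
  \<open>star S s \<otimes> s\<close> commute. Exchanging them in the middle of a product separates
  the factors from \<open>s\<close> and those from \<open>t\<close>, and each group
  collapses.\<close>

lemma star_mult:
  assumes s: "s \<in> carrier S" and t: "t \<in> carrier S"
  shows "star S (s \<otimes> t) = star S t \<otimes> star S s"
proof (rule star_unique)
  have comm: "t \<otimes> (star S t \<otimes> (star S s \<otimes> s)) = star S s \<otimes> (s \<otimes> (t \<otimes> star S t))"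
    using idem_commute[of "t \<otimes> star S t" "star S s \<otimes> s"] s t by (simp add: m_assoc)
  have "s \<otimes> t \<otimes> (star S t \<otimes> star S s \<otimes> (s \<otimes> t))
      = s \<otimes> (t \<otimes> (star S t \<otimes> (star S s \<otimes> s)) \<otimes> t)"
    using s t by (simp add: m_assoc)
  also have "\<dots> = (s \<otimes> (star S s \<otimes> s)) \<otimes> (t \<otimes> (star S t \<otimes> t))"
    unfolding comm using s t by (simp add: m_assoc)
  finally show "s \<otimes> t \<otimes> (star S t \<otimes> star S s \<otimes> (s \<otimes> t)) = s \<otimes> t"
    using s t by (simp add: mult_star_mult)
  have "star S t \<otimes> star S s \<otimes> (s \<otimes> t \<otimes> (star S t \<otimes> star S s))
      = star S t \<otimes> ((star S s \<otimes> (s \<otimes> (t \<otimes> star S t))) \<otimes> star S s)"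
    using s t by (simp add: m_assoc)
  also have "\<dots> = (star S t \<otimes> (t \<otimes> star S t)) \<otimes> (star S s \<otimes> (s \<otimes> star S s))"
    unfolding comm[symmetric] using s t by (simp add: m_assoc)
  finally show "star S t \<otimes> star S s \<otimes> (s \<otimes> t \<otimes> (star S t \<otimes> star S s)) = star S t \<otimes> star S s"
    using s t by (simp add: star_mult_star)
qed (use s t in auto)

section \<open>Corners, local monoids and arrows of the idempotent category\<close>

lemma corner_iff:
  assumes "f \<in> idempotents S" "e \<in> idempotents S"
  shows "s \<in> {f} <#> carrier S <#> {e} \<longleftrightarrow> s \<in> carrier S \<and> f \<otimes> s = s \<and> s \<otimes> e = s"
  using assms unfolding set_mult_def idempotents_def
  by (auto simp: m_assoc) (metis m_assoc m_closed)+

lemma carrier_local_monoid: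
  assumes "e \<in> idempotents S"
  shows "carrier (local_monoid S e) = {s \<in> carrier S. e \<otimes> s = s \<and> s \<otimes> e = s}"
  using corner_iff[OF assms assms] by (auto simp: local_monoid_def)

lemma local_monoid_closed:
  assumes "e \<in> idempotents S"
    and "x \<in> carrier (local_monoid S e)" "y \<in> carrier (local_monoid S e)"
  shows "x \<otimes>\<^bsub>local_monoid S e\<^esub> y \<in> carrier (local_monoid S e)"
proof -
  have "x \<otimes> y \<in> carrier (local_monoid S e)"
    using assms m_assoc[of e x y] m_assoc[of x y e] by (auto simp: carrier_local_monoid)
  then show ?thesis by (simp add: local_monoid_def)
qed

lemma idem_cat_simps [simp]:
  "obj (idem_cat S) = idempotents S" "ident (idem_cat S) f = (f, f, f)"
  "arr_comp (idem_cat S) (f, s, g) (g', t, h) = (f, s \<otimes> t, h)"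
  by (simp_all add: idem_cat_def)

lemma hom_idem_cat:
  "a \<in> hom_set (idem_cat S) e f \<longleftrightarrow> e \<in> idempotents S \<and> f \<in> idempotents S \<and>
     (\<exists>s \<in> carrier S. a = (f, s, e) \<and> f \<otimes> s = s \<and> s \<otimes> e = s)"
  by (auto simp: hom_set_def idem_cat_def corner_iff)

section \<open>Full idempotents\<close>

lemma full_iff:
  assumes "e \<in> carrier S"
  shows "carrier S = carrier S <#> {e} <#> carrier S \<longleftrightarrow>
    (\<forall>s \<in> carrier S. \<exists>a \<in> carrier S. \<exists>b \<in> carrier S. s = a \<otimes> (e \<otimes> b))"
proof -
  have mem: "s \<in> carrier S <#> {e} <#> carrier S \<longleftrightarrow>
      (\<exists>a \<in> carrier S. \<exists>b \<in> carrier S. s = a \<otimes> (e \<otimes> b))" for s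
    using assms by (auto simp: set_mult_def m_assoc)
  show ?thesis
    unfolding set_eq_iff mem using assms by blast
qed

text \<open>Since \<open>s = s \<otimes> (star S s \<otimes> s)\<close>, a factorisation of the
  idempotent \<open>star S s \<otimes> s\<close> through \<open>e\<close> yields one of
  \<open>s\<close>.\<close>

lemma full_iff_idem:
  assumes e: "e \<in> idempotents S"
  shows "carrier S = carrier S <#> {e} <#> carrier S \<longleftrightarrow>
    (\<forall>f \<in> idempotents S. \<exists>a \<in> carrier S. \<exists>b \<in> carrier S. f = a \<otimes> (e \<otimes> b))"
proof
  assume R: "\<forall>f \<in> idempotents S. \<exists>a \<in> carrier S. \<exists>b \<in> carrier S. f = a \<otimes> (e \<otimes> b)"
  have "\<exists>a \<in> carrier S. \<exists>b \<in> carrier S. s = a \<otimes> (e \<otimes> b)" if s: "s \<in> carrier S" for s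
  proof -
    obtain a b where ab: "a \<in> carrier S" "b \<in> carrier S" "star S s \<otimes> s = a \<otimes> (e \<otimes> b)"
      using R s by (meson star_mult_idem)
    have "s = (s \<otimes> a) \<otimes> (e \<otimes> b)"
      using mult_star_mult[OF s] ab s e by (simp add: m_assoc)
    with ab s show ?thesis by blast
  qed
  then show "carrier S = carrier S <#> {e} <#> carrier S"
    using e by (simp add: full_iff)
qed (use e full_iff in auto)

text \<open>Let U = eSe. As \<open>e\<close> lies in U, the product SUS contains SeS = S. The outer
  factors of USU absorb \<open>e\<close>, which keeps it inside U; conversely every \<open>x\<close>
  in U is \<open>e \<otimes> x \<otimes> e\<close>.\<close>

lemma enlargement_local_monoid:
  assumes e: "e \<in> idempotents S" and full: "carrier S = carrier S <#> {e} <#> carrier S"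
  shows "enlargement S (carrier (local_monoid S e))"
proof -
  let ?U = "carrier (local_monoid S e)"
  note U = carrier_local_monoid[OF e]
  have eU: "e \<in> ?U" using e by (simp add: U)
  have mult_U: "x \<otimes> s \<otimes> y \<in> ?U" if "x \<in> ?U" "y \<in> ?U" "s \<in> carrier S" for x y s
    using that e m_assoc[of e x "s \<otimes> y"] m_assoc[of "x \<otimes> s" y e] by (auto simp: U m_assoc)
  have "star S x \<in> ?U" if "x \<in> ?U" for x
    using that e star_mult[of x e] star_mult[of e x] by (auto simp: U)
  moreover have "x \<otimes> y \<in> ?U" if "x \<in> ?U" "y \<in> ?U" for x y
    using local_monoid_closed[OF e that] by (simp add: local_monoid_def)
  moreover have "carrier S <#> ?U <#> carrier S = carrier S"
  proof
    show "carrier S <#> ?U <#> carrier S \<subseteq> carrier S"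
      by (auto simp: set_mult_def U)
    have "carrier S <#> {e} <#> carrier S \<subseteq> carrier S <#> ?U <#> carrier S"
      using eU by (auto simp: set_mult_def)
    then show "carrier S \<subseteq> carrier S <#> ?U <#> carrier S"
      using full by simp
  qed
  moreover have "?U <#> carrier S <#> ?U = ?U"
  proof
    show "?U <#> carrier S <#> ?U \<subseteq> ?U"
      using mult_U by (auto simp: set_mult_def)
    show "?U \<subseteq> ?U <#> carrier S <#> ?U"
    proof
      fix x assume x: "x \<in> ?U"
      then have "x = e \<otimes> x \<otimes> e" by (simp add: U)
      with x eU show "x \<in> ?U <#> carrier S <#> ?U"
        unfolding set_mult_def U by blast
    qed
  qed
  ultimately show ?thesis
    by (auto simp: enlargement_def inverse_subsemigroup_def U)
qed

text \<open>Prepares essential surjectivity: in the idempotent category such an \<open>x\<close> is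
  an isomorphism onto \<open>f\<close> from \<open>star S x \<otimes> x\<close>, an idempotent of
  eSe.\<close>

lemma full_idem_dominates:
  assumes e: "e \<in> idempotents S" and full: "carrier S = carrier S <#> {e} <#> carrier S"
    and f: "f \<in> idempotents S"
  shows "\<exists>x \<in> carrier S. x \<otimes> star S x = f \<and> x \<otimes> e = x"
proof -
  obtain a b where ab [simp]: "a \<in> carrier S" "b \<in> carrier S" and f_eq: "f = a \<otimes> (e \<otimes> b)"
    using full e f by (auto simp: full_iff_idem)
  \<comment> \<open>The left part of the factorisation, cut down by \<open>f\<close> so that
    \<open>f \<otimes> x = x\<close>; the right part \<open>b\<close> then satisfies
    \<open>x \<otimes> b = f\<close>.\<close>
  define x where "x = f \<otimes> (a \<otimes> e)"
  have x [simp]: "x \<in> carrier S" "x \<otimes> e = x" "f \<otimes> x = x"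
    using e f by (auto simp: x_def m_assoc)
  have "x \<otimes> b = f \<otimes> (a \<otimes> (e \<otimes> b))"
    using f e by (simp add: x_def m_assoc)
  then have xb: "x \<otimes> b = f"
    using f by (simp flip: f_eq)
  \<comment> \<open>From \<open>f \<otimes> x = x\<close> the idempotent
    \<open>x \<otimes> star S x\<close> lies below \<open>f\<close>; commuting \<open>f\<close> to
    the right and writing it as \<open>x \<otimes> b\<close> shows that it equals
    \<open>f\<close>.\<close>
  have "x \<otimes> star S x = (f \<otimes> x) \<otimes> star S x" by simp
  also have "\<dots> = f \<otimes> (x \<otimes> star S x)" using f by (simp add: m_assoc del: x(3))
  also have "\<dots> = (x \<otimes> star S x) \<otimes> f"
    using f by (simp add: idem_commute)
  also have "\<dots> = (x \<otimes> (star S x \<otimes> x)) \<otimes> b"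
    by (simp add: m_assoc flip: xb)
  also have "\<dots> = f"
    by (simp add: mult_star_mult xb)
  finally show ?thesis by (intro bexI[of _ x]) auto
qed

end


section \<open>Morita contexts\<close>

context morita_context
begin

lemma lip_closed [simp]: "\<lbrakk>x \<in> X; y \<in> X\<rbrakk> \<Longrightarrow> lip x y \<in> carrier S"
  using lip_surj by force

lemma rip_closed [simp]: "\<lbrakk>x \<in> X; y \<in> X\<rbrakk> \<Longrightarrow> rip x y \<in> carrier T"
  using rip_surj by force

text \<open>\<open>lip_star\<close> swaps the arguments, so the scalar leaves the second argument on
  the right and starred.\<close>

lemma lip_lact_right:
  "\<lbrakk>s \<in> carrier S; x \<in> X; y \<in> X\<rbrakk> \<Longrightarrow> lip x (lact s y) = lip x y \<otimes>\<^bsub>S\<^esub> star S s"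
  by (metis lact_closed lip_closed lip_lact lip_star S.star_mult)

lemma rip_ract_left:
  "\<lbrakk>t \<in> carrier T; x \<in> X; y \<in> X\<rbrakk> \<Longrightarrow> rip (ract x t) y = star T t \<otimes>\<^bsub>T\<^esub> rip x y"
  by (metis ract_closed rip_closed rip_ract rip_star T.star_mult)

lemma lip_self_idem: "x \<in> X \<Longrightarrow> lip x x \<in> idempotents S"
  using lip_lact[of "lip x x" x x] by (intro S.idemI) (auto simp: lip_self)

text \<open>\<open>star\<close> reverses products, so acting through it turns the right action of
  \<open>T\<close> into a left one and the left action of \<open>S\<close> into a right one; the two
  pairings change places. This is the source of symmetry.\<close>

lemma opposite: "morita_context T S X (\<lambda>t x. ract x (star T t)) (\<lambda>x s. lact (star S s) x) rip lip"
proof (unfold_locales, goal_cases)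
  case (9 x y)
  then show ?case by (rule rip_star)
next
  case (10 x)
  then show ?case by (simp add: rip_self flip: rip_star)
next
  case (12 x y)
  then show ?case by (rule lip_star)
next
  case (13 x)
  then show ?case by (simp add: lip_self flip: lip_star)
next
  case (14 x y z)
  then show ?case by (simp add: lip_rip flip: rip_star lip_star)
qed (auto simp: lact_closed ract_closed S.star_mult T.star_mult lact_mult ract_mult act_commute
      lip_surj rip_surj rip_ract_left lip_lact_right)

lemma corner:
  assumes "monoid T"
  shows "\<exists>e \<in> idempotents S.
    carrier S = carrier S <#>\<^bsub>S\<^esub> {e} <#>\<^bsub>S\<^esub> carrier S \<and> T \<cong> local_monoid S e"
proof -
  interpret T': monoid T by fact
  have "\<one>\<^bsub>T\<^esub> \<in> (\<lambda>(x, y). rip x y) ` (X \<times> X)"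
    by (simp add: rip_surj)
  then obtain x y where x [simp]: "x \<in> X" and y: "y \<in> X" and one: "\<one>\<^bsub>T\<^esub> = rip x y"
    by auto
  \<comment> \<open>Since \<open>x\<close> is fixed by \<open>rip x x\<close>, this element is a
    left unit for \<open>rip x y\<close>, which is the identity of \<open>T\<close>; so
    \<open>rip x x\<close> is the identity itself.\<close>
  have "rip x x \<otimes>\<^bsub>T\<^esub> rip x y = rip x y"
    using rip_ract_left[of "rip x x" x y] y by (simp add: rip_self flip: rip_star)
  then have rip_xx [simp]: "rip x x = \<one>\<^bsub>T\<^esub>"
    by (simp flip: one)
  \<comment> \<open>Unitality of the action comes from \<open>z = ract z (rip z z)\<close>: the
    identity is absorbed by \<open>rip z z\<close>.\<close>
  have ract_one [simp]: "ract z \<one>\<^bsub>T\<^esub> = z" if "z \<in> X" for z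
    using that ract_mult[of z "rip z z" "\<one>\<^bsub>T\<^esub>"] by (simp add: rip_self)
  define e where "e = lip x x"
  have e [simp]: "e \<in> idempotents S" and ex [simp]: "lact e x = x"
    by (auto simp: e_def lip_self_idem lip_self)
  define \<phi> where "\<phi> t = lip (ract x t) x" for t
  have lact_\<phi>: "lact (\<phi> t) z = ract x (t \<otimes>\<^bsub>T\<^esub> rip x z)" if "t \<in> carrier T" "z \<in> X" for t z
    using that by (simp add: \<phi>_def lip_rip ract_closed ract_mult)
  have mem: "\<phi> t \<in> carrier (local_monoid S e)" if t: "t \<in> carrier T" for t
  proof -
    have "e \<otimes>\<^bsub>S\<^esub> \<phi> t = \<phi> t"
      using t lip_lact[of e "ract x t" x] act_commute[of e x t] by (simp add: \<phi>_def ract_closed)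
    moreover have "\<phi> t \<otimes>\<^bsub>S\<^esub> e = \<phi> t"
      using t lip_lact_right[of e "ract x t" x] by (simp add: \<phi>_def ract_closed)
    ultimately show ?thesis
      using t by (simp add: S.carrier_local_monoid \<phi>_def ract_closed)
  qed
  have "\<phi> \<in> iso T (local_monoid S e)"
    unfolding iso_iff
  proof (intro conjI)
    show "\<phi> \<in> hom T (local_monoid S e)"
    proof (rule homI)
      fix t u assume t: "t \<in> carrier T" and u: "u \<in> carrier T"
      have "\<phi> t \<otimes>\<^bsub>S\<^esub> \<phi> u = lip (lact (\<phi> t) (ract x u)) x"
        unfolding \<phi>_def[of u] using t u mem[OF t]
        by (simp add: lip_lact ract_closed S.carrier_local_monoid)
      also have "\<dots> = \<phi> (t \<otimes>\<^bsub>T\<^esub> u)"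
        using t u by (simp add: lact_\<phi> ract_closed rip_ract) (simp add: \<phi>_def)
      finally show "\<phi> (t \<otimes>\<^bsub>T\<^esub> u) = \<phi> t \<otimes>\<^bsub>local_monoid S e\<^esub> \<phi> u"
        by (simp add: local_monoid_def)
    qed (rule mem)
    \<comment> \<open>The left inverse is \<open>s \<mapsto> rip x (lact s x)\<close>:
      \<open>\<phi> t\<close> sends \<open>x\<close> to \<open>ract x t\<close>, and pairing with
      \<open>x\<close> returns \<open>t\<close> because \<open>rip x x\<close> is the
      identity.\<close>
    show "inj_on \<phi> (carrier T)"
    proof (rule inj_on_inverseI)
      show "rip x (lact (\<phi> t) x) = t" if "t \<in> carrier T" for t
        using that by (simp add: lact_\<phi> rip_ract)
    qed
    \<comment> \<open>The preimage is \<open>rip x (lact s x)\<close>. From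
      \<open>e \<otimes> s = s\<close> follows \<open>lact s x = ract x (rip x (lact s x))\<close>,
      and pairing this with \<open>x\<close> gives \<open>s \<otimes> e = s\<close>.\<close>
    have "\<exists>t \<in> carrier T. s = \<phi> t" if "s \<in> carrier (local_monoid S e)" for s
    proof -
      have s: "s \<in> carrier S" "e \<otimes>\<^bsub>S\<^esub> s = s" "s \<otimes>\<^bsub>S\<^esub> e = s"
        using that by (auto simp: S.carrier_local_monoid)
      then have sx: "lact s x \<in> X" by (simp add: lact_closed)
      have "lact s x = lact e (lact s x)"
        using s by (metis S.idem_closed e lact_mult x)
      also have "\<dots> = ract x (rip x (lact s x))"
        using sx by (simp add: e_def lip_rip)
      finally have "\<phi> (rip x (lact s x)) = lip (lact s x) x"
        by (simp add: \<phi>_def)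
      also have "\<dots> = s"
        using s by (simp add: lip_lact flip: e_def)
      finally show ?thesis using sx by (intro bexI[of _ "rip x (lact s x)"]) auto
    qed
    then show "\<phi> ` carrier T = carrier (local_monoid S e)"
      using mem by blast
  qed
  then have iso: "T \<cong> local_monoid S e"
    unfolding is_iso_def by blast
  have "\<exists>a \<in> carrier S. \<exists>b \<in> carrier S. s = a \<otimes>\<^bsub>S\<^esub> (e \<otimes>\<^bsub>S\<^esub> b)" if "s \<in> carrier S" for s
  proof -
    have "s \<in> (\<lambda>(x, y). lip x y) ` (X \<times> X)"
      using that by (simp add: lip_surj)
    then obtain y z where yz: "y \<in> X" "z \<in> X" "s = lip y z"
      by auto
    \<comment> \<open>As \<open>rip x x\<close> is the identity,
      \<open>y = lact (lip y x) x\<close>; inserting \<open>lact e x\<close> for \<open>x\<close>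
      then places \<open>e\<close> between two values of \<open>lip\<close>.\<close>
    have "s = lip (lact (lip y x) x) z"
      using yz by (simp add: lip_rip)
    also have "\<dots> = lip y x \<otimes>\<^bsub>S\<^esub> lip (lact e x) z"
      using yz by (simp add: lip_lact)
    also have "\<dots> = lip y x \<otimes>\<^bsub>S\<^esub> (e \<otimes>\<^bsub>S\<^esub> lip x z)"
      using yz by (subst lip_lact) auto
    finally show ?thesis using yz by (metis lip_closed x)
  qed
  then have "carrier S = carrier S <#>\<^bsub>S\<^esub> {e} <#>\<^bsub>S\<^esub> carrier S"
    by (simp add: S.full_iff)
  with e iso show ?thesis by blast
qed

end

text \<open>The opposite context still lives on pairs of type \<open>'a \<times> 'b\<close>, while
  the definition for \<open>T\<close> and \<open>S\<close> asks for \<open>'b \<times> 'a\<close>;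
  \<open>strongly_morita_equivalentI\<close> moves it there.\<close>

lemma strongly_morita_equivalent_sym:
  "strongly_morita_equivalent S T \<Longrightarrow> strongly_morita_equivalent T S"
  unfolding strongly_morita_equivalent_def[of S T]
  by (blast dest: morita_context.opposite intro: strongly_morita_equivalentI)

lemma strongly_morita_equivalent_corner:
  fixes S :: "('a, 'm) monoid_scheme" and T :: "('b, 'n) monoid_scheme"
  assumes "strongly_morita_equivalent S T" "monoid T"
  shows "\<exists>e \<in> idempotents S.
    carrier S = carrier S <#>\<^bsub>S\<^esub> {e} <#>\<^bsub>S\<^esub> carrier S \<and> T \<cong> local_monoid S e"
proof -
  obtain X :: "('a \<times> 'b) set" and lact ract lip rip where "morita_context S T X lact ract lip rip"
    using assms(1) by (auto simp: strongly_morita_equivalent_def)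
  from morita_context.corner[OF this assms(2)] show ?thesis .
qed

section \<open>Fully faithful, essentially surjective functors\<close>

context category
begin

lemma hom_set_obj: "a \<in> hom_set C x y \<Longrightarrow> x \<in> obj C \<and> y \<in> obj C"
  using src_obj tgt_obj by (auto simp: hom_set_def)

lemma compose_cancel_left:
  assumes "b \<in> hom_set C y z" "b' \<in> hom_set C z y" "arr_comp C b' b = ident C y" "a \<in> hom_set C x y"
  shows "arr_comp C b' (arr_comp C b a) = a"
  using assms compose_assoc[of b' z y b y a x] by (simp add: compose_ident_left)

lemma compose_cancel_right:
  assumes "b \<in> hom_set C x y" "b' \<in> hom_set C y x" "arr_comp C b b' = ident C y" "a \<in> hom_set C y z"
  shows "arr_comp C (arr_comp C a b) b' = a"
  using assms compose_assoc[of a y z b x b' y] by (simp add: compose_ident_right)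

end

text \<open>Composing the naturality square of \<eta> with the inverse components on both sides
  gives the square for \<theta>. This turns the second natural isomorphism of an equivalence around,
  so that it starts at the identity.\<close>

lemma natural_iso_inverse:
  assumes "natural_iso C D Fo Fa Go Ga \<eta>"
  obtains \<theta> where "natural_iso C D Go Ga Fo Fa \<theta>"
proof -
  interpret natural_iso C D Fo Fa Go Ga \<eta> by fact
  have "\<exists>b. \<eta> x \<in> hom_set D (Fo x) (Go x) \<and> b \<in> hom_set D (Go x) (Fo x) \<and>
      arr_comp D b (\<eta> x) = ident D (Fo x) \<and> arr_comp D (\<eta> x) b = ident D (Go x)"
    if "x \<in> obj C" for x
    using component_iso[OF that] by (auto simp: isomorphisms_def)
  then obtain \<theta> where \<theta>: "\<And>x. x \<in> obj C \<Longrightarrow> \<eta> x \<in> hom_set D (Fo x) (Go x) \<and>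
      \<theta> x \<in> hom_set D (Go x) (Fo x) \<and>
      arr_comp D (\<theta> x) (\<eta> x) = ident D (Fo x) \<and> arr_comp D (\<eta> x) (\<theta> x) = ident D (Go x)"
    by metis
  have "natural_iso C D Go Ga Fo Fa \<theta>"
  proof unfold_locales
    show "\<theta> x \<in> isomorphisms D (Go x) (Fo x)" if "x \<in> obj C" for x
      using \<theta>[OF that] by (auto simp: isomorphisms_def)
    fix a x y assume a: "a \<in> hom_set C x y"
    then have x: "x \<in> obj C" and y: "y \<in> obj C"
      using F.C.hom_set_obj by auto
    note homs = F.map_hom[OF a] G.map_hom[OF a] \<theta>[OF x] \<theta>[OF y]
    have "arr_comp D (\<theta> y) (Ga a) = arr_comp D (\<theta> y) (arr_comp D (arr_comp D (Ga a) (\<eta> x)) (\<theta> x))"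
      using homs F.D.compose_cancel_right[of "\<eta> x" "Fo x" "Go x" "\<theta> x" "Ga a" "Go y"] by simp
    also have "\<dots> = arr_comp D (\<theta> y) (arr_comp D (\<eta> y) (arr_comp D (Fa a) (\<theta> x)))"
      using homs F.D.compose_assoc[of "\<eta> y" "Fo y" "Go y" "Fa a" "Fo x" "\<theta> x" "Go x"]
      by (simp flip: naturality[OF a])
    also have "\<dots> = arr_comp D (Fa a) (\<theta> x)"
      using homs F.D.compose_hom[of "Fa a" "Fo x" "Fo y" "\<theta> x" "Go x"]
        F.D.compose_cancel_left[of "\<eta> y" "Fo y" "Go y" "\<theta> y" "arr_comp D (Fa a) (\<theta> x)" "Go x"]
      by simp
    finally show "arr_comp D (\<theta> y) (Ga a) = arr_comp D (Fa a) (\<theta> x)" .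
  qed
  then show thesis by (rule that)
qed

text \<open>Naturality expresses \<open>arr_comp C (\<eta> y) a\<close> through \<open>Fa a\<close>
  alone, and \<open>\<eta> y\<close> can be cancelled on the left.\<close>

lemma natural_iso_id_faithful:
  assumes "natural_iso C C id id (Go \<circ> Fo) (Ga \<circ> Fa) \<eta>"
    and ab: "a \<in> hom_set C x y" "b \<in> hom_set C x y" and eq: "Fa a = Fa b"
  shows "a = b"
proof -
  interpret natural_iso C C id id "Go \<circ> Fo" "Ga \<circ> Fa" \<eta> by fact
  have "y \<in> obj C" using ab F.C.hom_set_obj by auto
  then obtain u where u: "\<eta> y \<in> hom_set C y (Go (Fo y))" "u \<in> hom_set C (Go (Fo y)) y"
      "arr_comp C u (\<eta> y) = ident C y"
    using component_iso[of y] by (auto simp: isomorphisms_def)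
  have "arr_comp C (\<eta> y) a = arr_comp C (\<eta> y) b"
    using naturality[OF ab(1)] naturality[OF ab(2)] eq by simp
  then show ?thesis
    using F.C.compose_cancel_left[OF u] ab by metis
qed

text \<open>Both functors are faithful, each by its natural isomorphism from the identity.
  Faithfulness of \<open>Fa\<close> also gives fullness of \<open>Ga\<close>, and
  \<open>\<eta> z\<close> shows that \<open>z\<close> is isomorphic to
  \<open>Go (Fo z)\<close>.\<close>

lemma equivalent_categories_fully_faithful:
  assumes "equivalent_categories C D"
  obtains Go Ga where "cat_functor D C Go Ga"
    "\<And>x y. \<lbrakk>x \<in> obj D; y \<in> obj D\<rbrakk> \<Longrightarrow> bij_betw Ga (hom_set D x y) (hom_set C (Go x) (Go y))"
    "\<And>z. z \<in> obj C \<Longrightarrow> \<exists>x \<in> obj D. isomorphisms C z (Go x) \<noteq> {}"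
proof -
  obtain Fo Fa Go Ga \<eta> \<epsilon> where F: "cat_functor C D Fo Fa" and G: "cat_functor D C Go Ga"
    and \<eta>: "natural_iso C C id id (Go \<circ> Fo) (Ga \<circ> Fa) \<eta>"
    and \<epsilon>: "natural_iso D D (Fo \<circ> Go) (Fa \<circ> Ga) id id \<epsilon>"
    using assms by (auto simp: equivalent_categories_def)
  obtain \<beta> where \<beta>: "natural_iso D D id id (Fo \<circ> Go) (Fa \<circ> Ga) \<beta>"
    using natural_iso_inverse[OF \<epsilon>] .
  interpret F: cat_functor C D Fo Fa by fact
  interpret G: cat_functor D C Go Ga by fact
  interpret \<eta>: natural_iso C C id id "Go \<circ> Fo" "Ga \<circ> Fa" \<eta> by fact
  interpret \<beta>: natural_iso D D id id "Fo \<circ> Go" "Fa \<circ> Ga" \<beta> by fact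
  have "bij_betw Ga (hom_set D x y) (hom_set C (Go x) (Go y))" if x: "x \<in> obj D" and y: "y \<in> obj D" for x y
    unfolding bij_betw_def
  proof (intro conjI equalityI subsetI)
    show "inj_on Ga (hom_set D x y)"
      using natural_iso_id_faithful[OF \<beta>] by (auto simp: inj_on_def)
    fix c assume c: "c \<in> hom_set C (Go x) (Go y)"
    obtain u where u: "\<beta> x \<in> hom_set D x (Fo (Go x))" "u \<in> hom_set D (Fo (Go x)) x"
        "arr_comp D u (\<beta> x) = ident D x" "arr_comp D (\<beta> x) u = ident D (Fo (Go x))"
      using \<beta>.component_iso[OF x] by (auto simp: isomorphisms_def)
    obtain v where v: "\<beta> y \<in> hom_set D y (Fo (Go y))" "v \<in> hom_set D (Fo (Go y)) y"
        "arr_comp D v (\<beta> y) = ident D y" "arr_comp D (\<beta> y) v = ident D (Fo (Go y))"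
      using \<beta>.component_iso[OF y] by (auto simp: isomorphisms_def)
    note Fc = F.map_hom[OF c]
    \<comment> \<open>The candidate preimage of \<open>c\<close> is \<open>Fa c\<close> carried back
      along \<beta>. Naturality at \<open>a\<close> then forces
      \<open>Fa (Ga a) = Fa c\<close>.\<close>
    define a where "a = arr_comp D v (arr_comp D (Fa c) (\<beta> x))"
    have a: "a \<in> hom_set D x y"
      unfolding a_def using u v Fc by (blast intro: F.D.compose_hom)
    have "arr_comp D (Fa (Ga a)) (\<beta> x) = arr_comp D (\<beta> y) a"
      using \<beta>.naturality[OF a] by simp
    also have "\<dots> = arr_comp D (Fa c) (\<beta> x)"
      unfolding a_def using u v Fc by (blast intro: F.D.compose_cancel_left F.D.compose_hom)
    finally have "Fa (Ga a) = Fa c"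
      using F.D.compose_cancel_right[OF u(1,2,4)] F.map_hom[OF G.map_hom[OF a]] Fc by metis
    then have "Ga a = c"
      using natural_iso_id_faithful[OF \<eta>] G.map_hom[OF a] c by blast
    then show "c \<in> Ga ` hom_set D x y" using a by blast
  qed (auto intro: G.map_hom)
  moreover have "\<exists>x \<in> obj D. isomorphisms C z (Go x) \<noteq> {}" if "z \<in> obj C" for z
    using \<eta>.component_iso[OF that] F.map_obj[OF that] by auto
  ultimately show thesis using that G by blast
qed

section \<open>Construction of a quasi-inverse functor\<close>

lemma fully_faithful_equivalent_categories:
  assumes "cat_functor D C Go Ga"
    and ff: "\<And>x y. \<lbrakk>x \<in> obj D; y \<in> obj D\<rbrakk> \<Longrightarrow> bij_betw Ga (hom_set D x y) (hom_set C (Go x) (Go y))"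
    and es: "\<And>z. z \<in> obj C \<Longrightarrow> \<exists>x \<in> obj D. isomorphisms C z (Go x) \<noteq> {}"
  shows "equivalent_categories C D"
proof -
  interpret G: cat_functor D C Go Ga by fact
  note CC = G.D.compose_hom and DC = G.C.compose_hom
  have "\<exists>x u v. x \<in> obj D \<and> u \<in> hom_set C z (Go x) \<and> v \<in> hom_set C (Go x) z \<and>
      arr_comp C v u = ident C z \<and> arr_comp C u v = ident C (Go x)" if "z \<in> obj C" for z
    using es[OF that] by (auto simp: isomorphisms_def)
  then obtain Fo u v where Fo [simp]: "\<And>z. z \<in> obj C \<Longrightarrow> Fo z \<in> obj D"
    and u: "\<And>z. z \<in> obj C \<Longrightarrow> u z \<in> hom_set C z (Go (Fo z))"
    and v: "\<And>z. z \<in> obj C \<Longrightarrow> v z \<in> hom_set C (Go (Fo z)) z"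
    and vu: "\<And>z. z \<in> obj C \<Longrightarrow> arr_comp C (v z) (u z) = ident C z"
    and uv: "\<And>z. z \<in> obj C \<Longrightarrow> arr_comp C (u z) (v z) = ident C (Go (Fo z))"
    by metis
  define lift where "lift x y = inv_into (hom_set D x y) Ga" for x y
  have lift_hom: "lift x y c \<in> hom_set D x y" and Ga_lift: "Ga (lift x y c) = c"
    if "x \<in> obj D" "y \<in> obj D" "c \<in> hom_set C (Go x) (Go y)" for x y c
    using ff[OF that(1,2)] that(3)
    by (auto simp: lift_def bij_betw_def intro: inv_into_into f_inv_into_f)
  have Ga_inj: "a = b" if "a \<in> hom_set D x y" "b \<in> hom_set D x y" "Ga a = Ga b" for a b x y
    using ff[of x y] that G.C.hom_set_obj[OF that(1)] by (auto simp: bij_betw_def inj_on_def)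
  \<comment> \<open>The arrow \<open>c\<close> conjugated by the chosen isomorphisms lies between
    objects in the image of \<open>Go\<close>, so it lifts uniquely through \<open>Ga\<close>; the
    lift is the value of the quasi-inverse at \<open>c\<close>.\<close>
  define conj where "conj c = arr_comp C (u (tgt C c)) (arr_comp C c (v (src C c)))" for c
  define Fa where "Fa c = lift (Fo (src C c)) (Fo (tgt C c)) (conj c)" for c
  have conj: "conj c = arr_comp C (u w) (arr_comp C c (v z))"
      "conj c \<in> hom_set C (Go (Fo z)) (Go (Fo w))"
      "Fa c \<in> hom_set D (Fo z) (Fo w)" "Ga (Fa c) = conj c"
    if c: "c \<in> hom_set C z w" for c z w
  proof -
    have zw: "z \<in> obj C" "w \<in> obj C" and st: "src C c = z" "tgt C c = w"
      using G.D.hom_set_obj[OF c] c by (auto simp: hom_set_def)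
    show eq: "conj c = arr_comp C (u w) (arr_comp C c (v z))"
      by (simp add: conj_def st)
    show mem: "conj c \<in> hom_set C (Go (Fo z)) (Go (Fo w))"
      unfolding eq using c u v zw by (blast intro: CC)
    show "Fa c \<in> hom_set D (Fo z) (Fo w)" "Ga (Fa c) = conj c"
      using lift_hom[OF _ _ mem] Ga_lift[OF _ _ mem] zw by (auto simp: Fa_def st)
  qed
  have conj_comp: "conj (arr_comp C d c) = arr_comp C (conj d) (conj c)"
    if c: "c \<in> hom_set C z w" and d: "d \<in> hom_set C w y" for c d z w y
  proof -
    have o: "z \<in> obj C" "w \<in> obj C" "y \<in> obj C"
      using G.D.hom_set_obj[OF c] G.D.hom_set_obj[OF d] by auto
    note h = u[OF o(1)] u[OF o(2)] u[OF o(3)] v[OF o(1)] v[OF o(2)] v[OF o(3)] c d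
    have cv: "arr_comp C c (v z) \<in> hom_set C (Go (Fo z)) w"
      and dv: "arr_comp C d (v w) \<in> hom_set C (Go (Fo w)) y"
      using h by (blast intro: CC)+
    have "arr_comp C (conj d) (conj c)
        = arr_comp C (u y) (arr_comp C (arr_comp C d (v w)) (arr_comp C (u w) (arr_comp C c (v z))))"
      unfolding conj(1)[OF c] conj(1)[OF d]
      using G.D.compose_assoc[OF h(3) dv CC[OF h(2) cv]] .
    also have "\<dots> = arr_comp C (u y) (arr_comp C d (arr_comp C (v w) (arr_comp C (u w) (arr_comp C c (v z)))))"
      using G.D.compose_assoc[OF d h(5) CC[OF h(2) cv]] by simp
    also have "\<dots> = arr_comp C (u y) (arr_comp C d (arr_comp C c (v z)))"
      using G.D.compose_cancel_left[OF h(2) h(5) vu[OF o(2)] cv] by simp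
    also have "\<dots> = conj (arr_comp C d c)"
      unfolding conj(1)[OF CC[OF d c]] using G.D.compose_assoc[OF d c h(4)] by simp
    finally show ?thesis by simp
  qed
  \<comment> \<open>Since \<open>Ga\<close> is faithful, each functor law may be checked after
    applying \<open>Ga\<close>, where it becomes an identity about \<open>conj\<close>.\<close>
  have F: "cat_functor C D Fo Fa"
  proof unfold_locales
    show "Fa (ident C z) = ident D (Fo z)" if z: "z \<in> obj C" for z
    proof (rule Ga_inj)
      show "Fa (ident C z) \<in> hom_set D (Fo z) (Fo z)"
        by (rule conj(3)[OF G.D.ident_hom[OF z]])
      show "ident D (Fo z) \<in> hom_set D (Fo z) (Fo z)"
        using z by (simp add: G.C.ident_hom)
      show "Ga (Fa (ident C z)) = Ga (ident D (Fo z))"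
        using z conj(4)[OF G.D.ident_hom[OF z]] conj(1)[OF G.D.ident_hom[OF z]]
        by (simp add: G.map_ident uv G.D.compose_ident_left[OF v])
    qed
    show "Fa (arr_comp C d c) = arr_comp D (Fa d) (Fa c)"
      if d: "d \<in> hom_set C w y" and c: "c \<in> hom_set C z w" for c d z w y
    proof (rule Ga_inj)
      show "Fa (arr_comp C d c) \<in> hom_set D (Fo z) (Fo y)"
        by (rule conj(3)[OF CC[OF d c]])
      show "arr_comp D (Fa d) (Fa c) \<in> hom_set D (Fo z) (Fo y)"
        by (rule DC[OF conj(3)[OF d] conj(3)[OF c]])
      show "Ga (Fa (arr_comp C d c)) = Ga (arr_comp D (Fa d) (Fa c))"
        by (simp add: conj(4)[OF CC[OF d c]] conj_comp[OF c d] conj(4)[OF c] conj(4)[OF d]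
            G.map_compose[OF conj(3)[OF d] conj(3)[OF c]])
    qed
  qed (auto intro: conj(3))
  interpret F: cat_functor C D Fo Fa by (rule F)
  have id_functor: "cat_functor A A id id" if "category A" for A :: "('x, 'y) cat"
    using that by (simp add: cat_functor_def cat_functor_axioms_def)
  have comp_C: "cat_functor C C (Go \<circ> Fo) (Ga \<circ> Fa)"
    by unfold_locales
      (auto intro: F.map_hom G.map_hom G.map_obj simp: F.map_ident G.map_ident F.map_compose
        G.map_compose[OF F.map_hom F.map_hom])
  have comp_D: "cat_functor D D (Fo \<circ> Go) (Fa \<circ> Ga)"
    by unfold_locales
      (auto intro: F.map_hom G.map_hom G.map_obj simp: F.map_ident G.map_ident G.map_obj G.map_compose
        F.map_compose[OF G.map_hom G.map_hom])
  \<comment> \<open>The chosen isomorphisms \<open>u\<close> form the unit: conjugation was defined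
    so that their squares commute.\<close>
  have "natural_iso C C id id (Go \<circ> Fo) (Ga \<circ> Fa) u"
  proof (intro natural_iso.intro natural_iso_axioms.intro comp_C id_functor G.D.category_axioms)
    show "u z \<in> isomorphisms C (id z) ((Go \<circ> Fo) z)" if "z \<in> obj C" for z
      using u[OF that] v[OF that] vu[OF that] uv[OF that] by (auto simp: isomorphisms_def)
    fix c z w assume c: "c \<in> hom_set C z w"
    then have o: "z \<in> obj C" "w \<in> obj C" using G.D.hom_set_obj by auto
    have "arr_comp C (conj c) (u z) = arr_comp C (u w) (arr_comp C (arr_comp C c (v z)) (u z))"
      unfolding conj(1)[OF c] using G.D.compose_assoc[OF u[OF o(2)] CC[OF c v[OF o(1)]] u[OF o(1)]] .
    also have "\<dots> = arr_comp C (u w) c"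
      using G.D.compose_cancel_right[OF v[OF o(1)] u[OF o(1)] vu[OF o(1)] c] by simp
    finally show "arr_comp C (u w) (id c) = arr_comp C ((Ga \<circ> Fa) c) (u z)"
      by (simp add: conj(4)[OF c])
  qed
  \<comment> \<open>The counit at \<open>x\<close> is the lift of \<open>v (Go x)\<close>. Its
    inverse is the lift of \<open>u (Go x)\<close>, and all required equations follow by applying
    the faithful \<open>Ga\<close>.\<close>
  moreover define \<epsilon> where "\<epsilon> x = lift (Fo (Go x)) x (v (Go x))" for x
  have "natural_iso D D (Fo \<circ> Go) (Fa \<circ> Ga) id id \<epsilon>"
  proof (intro natural_iso.intro natural_iso_axioms.intro comp_D id_functor G.C.category_axioms)
    have \<epsilon>: "\<epsilon> x \<in> hom_set D (Fo (Go x)) x" "Ga (\<epsilon> x) = v (Go x)" if "x \<in> obj D" for x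
      using that lift_hom[OF _ _ v] Ga_lift[OF _ _ v] by (auto simp: \<epsilon>_def G.map_obj)
    show "\<epsilon> x \<in> isomorphisms D ((Fo \<circ> Go) x) (id x)" if x: "x \<in> obj D" for x
    proof -
      let ?z = "Go x" and ?d = "lift x (Fo (Go x)) (u (Go x))"
      have z: "?z \<in> obj C" and Fz: "Fo ?z \<in> obj D" using x by (auto simp: G.map_obj)
      have d: "?d \<in> hom_set D x (Fo ?z)" "Ga ?d = u ?z"
        using lift_hom[OF x Fz u[OF z]] Ga_lift[OF x Fz u[OF z]] by auto
      have "arr_comp D ?d (\<epsilon> x) = ident D (Fo ?z)"
        by (rule Ga_inj[OF DC[OF d(1) \<epsilon>(1)[OF x]] G.C.ident_hom[OF Fz]])
          (simp add: G.map_compose[OF d(1) \<epsilon>(1)[OF x]] d(2) \<epsilon>(2)[OF x] uv z G.map_ident[OF Fz])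
      moreover have "arr_comp D (\<epsilon> x) ?d = ident D x"
        by (rule Ga_inj[OF DC[OF \<epsilon>(1)[OF x] d(1)] G.C.ident_hom[OF x]])
          (simp add: G.map_compose[OF \<epsilon>(1)[OF x] d(1)] d(2) \<epsilon>(2)[OF x] vu z G.map_ident[OF x])
      ultimately show ?thesis
        using \<epsilon>(1)[OF x] d(1) by (auto simp: isomorphisms_def)
    qed
    fix a x y assume a: "a \<in> hom_set D x y"
    then have x: "x \<in> obj D" and y: "y \<in> obj D" using G.C.hom_set_obj by auto
    then have o: "Go x \<in> obj C" "Go y \<in> obj C" by (auto simp: G.map_obj)
    note Ga = G.map_hom[OF a]
    have "arr_comp D (\<epsilon> y) (Fa (Ga a)) = arr_comp D a (\<epsilon> x)"
    proof (rule Ga_inj[OF DC[OF \<epsilon>(1)[OF y] conj(3)[OF Ga]] DC[OF a \<epsilon>(1)[OF x]]])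
      have "Ga (arr_comp D (\<epsilon> y) (Fa (Ga a))) = arr_comp C (v (Go y)) (conj (Ga a))"
        by (simp add: G.map_compose[OF \<epsilon>(1)[OF y] conj(3)[OF Ga]] \<epsilon>(2)[OF y] conj(4)[OF Ga])
      also have "\<dots> = arr_comp C (Ga a) (v (Go x))"
        unfolding conj(1)[OF Ga]
        by (rule G.D.compose_cancel_left[OF u[OF o(2)] v[OF o(2)] vu[OF o(2)] CC[OF Ga v[OF o(1)]]])
      also have "\<dots> = Ga (arr_comp D a (\<epsilon> x))"
        by (simp add: G.map_compose[OF a \<epsilon>(1)[OF x]] \<epsilon>(2)[OF x])
      finally show "Ga (arr_comp D (\<epsilon> y) (Fa (Ga a))) = Ga (arr_comp D a (\<epsilon> x))" .
    qed
    then show "arr_comp D (\<epsilon> y) ((Fa \<circ> Ga) a) = arr_comp D (id a) (\<epsilon> x)" by simp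
  qed
  ultimately show ?thesis
    unfolding equivalent_categories_def using F assms(1) by blast
qed

section \<open>Full corners\<close>

text \<open>Fixing the isomorphism \<phi> as a map lets the Morita context and the functor be built
  from the same data.\<close>

locale full_corner = S: inverse_semigroup S + T: inverse_semigroup T
  for S :: "('a, 'm) monoid_scheme" and T :: "('b, 'n) monoid_scheme" +
  fixes e :: 'a and \<phi> :: "'b \<Rightarrow> 'a"
  assumes e [simp]: "e \<in> idempotents S"
    and full: "carrier S = carrier S <#>\<^bsub>S\<^esub> {e} <#>\<^bsub>S\<^esub> carrier S"
    and \<phi>_iso: "\<phi> \<in> iso T (local_monoid S e)"
begin

text \<open>The inverse of \<phi>; its values are meaningful only on eSe.\<close>

definition \<psi> where "\<psi> = inv_into (carrier T) \<phi>"

lemma \<phi>_closed [simp]: "t \<in> carrier T \<Longrightarrow> \<phi> t \<in> carrier S"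
  and \<phi>_unit_left [simp]: "t \<in> carrier T \<Longrightarrow> e \<otimes>\<^bsub>S\<^esub> \<phi> t = \<phi> t"
  and \<phi>_unit_right [simp]: "t \<in> carrier T \<Longrightarrow> \<phi> t \<otimes>\<^bsub>S\<^esub> e = \<phi> t"
  using \<phi>_iso by (auto simp: iso_iff S.carrier_local_monoid)

lemma \<phi>_mult: "\<lbrakk>t \<in> carrier T; u \<in> carrier T\<rbrakk> \<Longrightarrow> \<phi> (t \<otimes>\<^bsub>T\<^esub> u) = \<phi> t \<otimes>\<^bsub>S\<^esub> \<phi> u"
  using \<phi>_iso by (auto simp: iso_iff hom_def local_monoid_def)

lemma \<psi>_\<phi> [simp]: "t \<in> carrier T \<Longrightarrow> \<psi> (\<phi> t) = t"
  using \<phi>_iso by (simp add: iso_iff \<psi>_def)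

lemma \<psi>_closed [simp]:
    "\<lbrakk>s \<in> carrier S; e \<otimes>\<^bsub>S\<^esub> s = s; s \<otimes>\<^bsub>S\<^esub> e = s\<rbrakk> \<Longrightarrow> \<psi> s \<in> carrier T"
  and \<phi>_\<psi> [simp]:
    "\<lbrakk>s \<in> carrier S; e \<otimes>\<^bsub>S\<^esub> s = s; s \<otimes>\<^bsub>S\<^esub> e = s\<rbrakk> \<Longrightarrow> \<phi> (\<psi> s) = s"
proof -
  assume "s \<in> carrier S" "e \<otimes>\<^bsub>S\<^esub> s = s" "s \<otimes>\<^bsub>S\<^esub> e = s"
  then have "s \<in> \<phi> ` carrier T"
    using \<phi>_iso by (simp add: iso_iff S.carrier_local_monoid)
  then show "\<psi> s \<in> carrier T" "\<phi> (\<psi> s) = s"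
    by (auto simp: \<psi>_def inv_into_into f_inv_into_f)
qed

lemma \<phi>_inj: "\<lbrakk>\<phi> t = \<phi> u; t \<in> carrier T; u \<in> carrier T\<rbrakk> \<Longrightarrow> t = u"
  by (metis \<psi>_\<phi>)

text \<open>The equations characterising an inverse pass through the homomorphism \<phi>, so
  uniqueness in \<open>S\<close> applies.\<close>

lemma \<phi>_star: "t \<in> carrier T \<Longrightarrow> \<phi> (star T t) = star S (\<phi> t)"
  by (rule S.star_unique[symmetric])
    (auto simp: T.mult_star_mult T.star_mult_star simp flip: \<phi>_mult)

lemma \<phi>_idem: "f \<in> idempotents T \<Longrightarrow> \<phi> f \<in> idempotents S"
  by (intro S.idemI) (auto simp flip: \<phi>_mult)

text \<open>On Se one has \<open>y \<otimes> e = y\<close> and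
  \<open>e \<otimes> star S x = star S x\<close>, so \<open>star S x \<otimes> y\<close> lies in eSe
  and \<psi> brings it back to \<open>T\<close>. The compatibility of the two pairings is then
  associativity in \<open>S\<close>.\<close>

lemma morita_context_corner:
  "morita_context S T {x \<in> carrier S. x \<otimes>\<^bsub>S\<^esub> e = x}
     (\<lambda>s x. s \<otimes>\<^bsub>S\<^esub> x) (\<lambda>x t. x \<otimes>\<^bsub>S\<^esub> \<phi> t)
     (\<lambda>x y. x \<otimes>\<^bsub>S\<^esub> star S y) (\<lambda>x y. \<psi> (star S x \<otimes>\<^bsub>S\<^esub> y))"
proof -
  let ?X = "{x \<in> carrier S. x \<otimes>\<^bsub>S\<^esub> e = x}"
  have star_X: "e \<otimes>\<^bsub>S\<^esub> star S x = star S x" if "x \<in> carrier S" "x \<otimes>\<^bsub>S\<^esub> e = x" for x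
    using that S.star_mult[of x e] by simp
  have star_X': "e \<otimes>\<^bsub>S\<^esub> (star S x \<otimes>\<^bsub>S\<^esub> y) = star S x \<otimes>\<^bsub>S\<^esub> y"
    if "x \<in> carrier S" "x \<otimes>\<^bsub>S\<^esub> e = x" "y \<in> carrier S" for x y
    using star_X[of x] that by (simp flip: S.m_assoc)
  have rip [simp]: "\<psi> (star S x \<otimes>\<^bsub>S\<^esub> y) \<in> carrier T"
      "\<phi> (\<psi> (star S x \<otimes>\<^bsub>S\<^esub> y)) = star S x \<otimes>\<^bsub>S\<^esub> y"
    if "x \<in> carrier S" "x \<otimes>\<^bsub>S\<^esub> e = x" "y \<in> carrier S" "y \<otimes>\<^bsub>S\<^esub> e = y" for x y
    using that by (auto simp: star_X' S.m_assoc)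
  show ?thesis
  proof (unfold_locales, goal_cases)
    case 6
    show ?case
    proof (intro equalityI subsetI)
      fix s assume "s \<in> carrier S"
      then obtain a b where ab: "a \<in> carrier S" "b \<in> carrier S" "s = a \<otimes>\<^bsub>S\<^esub> (e \<otimes>\<^bsub>S\<^esub> b)"
        using full by (auto simp: S.full_iff)
      \<comment> \<open>The middle \<open>e\<close> is doubled, one copy going to each side; the
        right factor is written as a star in order to become the second argument of the
        pairing.\<close>
      then have "s = (a \<otimes>\<^bsub>S\<^esub> e) \<otimes>\<^bsub>S\<^esub> star S (star S b \<otimes>\<^bsub>S\<^esub> e)"
        by (simp add: S.star_mult S.m_assoc)
      moreover have "a \<otimes>\<^bsub>S\<^esub> e \<in> ?X" "star S b \<otimes>\<^bsub>S\<^esub> e \<in> ?X"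
        using ab by (auto simp: S.m_assoc)
      ultimately show "s \<in> (\<lambda>(x, y). x \<otimes>\<^bsub>S\<^esub> star S y) ` (?X \<times> ?X)"
        by (intro image_eqI[of _ _ "(a \<otimes>\<^bsub>S\<^esub> e, star S b \<otimes>\<^bsub>S\<^esub> e)"]) auto
    qed auto
  next
    case 7
    show ?case
    proof (intro equalityI subsetI)
      fix t assume t: "t \<in> carrier T"
      then have "t = \<psi> (star S e \<otimes>\<^bsub>S\<^esub> \<phi> t)" by simp
      with t show "t \<in> (\<lambda>(x, y). \<psi> (star S x \<otimes>\<^bsub>S\<^esub> y)) ` (?X \<times> ?X)"
        by (intro image_eqI[of _ _ "(e, \<phi> t)"]) auto
    qed auto
  next
    \<comment> \<open>Identities between elements of \<open>T\<close> are compared after applying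
      the injective \<phi>, which removes \<psi>.\<close>
    case (11 x y t)
    then show ?case by (intro \<phi>_inj) (auto simp: \<phi>_mult S.m_assoc)
  next
    case (12 x y)
    then show ?case by (intro \<phi>_inj) (auto simp: \<phi>_star S.star_mult)
  qed (auto simp: S.m_assoc \<phi>_mult S.star_mult S.mult_star_mult)
qed

text \<open>The functor applies \<phi> to all three entries of an arrow. Being injective, \<phi>
  makes it faithful; surjectivity onto eSe gives fullness, and fullness of \<open>e\<close> gives
  essential surjectivity.\<close>

lemma equivalent_categories_corner: "equivalent_categories (idem_cat S) (idem_cat T)"
proof (rule fully_faithful_equivalent_categories)
  let ?Ga = "\<lambda>(f, t, g). (\<phi> f, \<phi> t, \<phi> g)"
  show "cat_functor (idem_cat T) (idem_cat S) \<phi> ?Ga"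
  proof (intro cat_functor.intro cat_functor_axioms.intro S.category_idem_cat T.category_idem_cat)
    show "?Ga a \<in> hom_set (idem_cat S) (\<phi> g) (\<phi> f)" if "a \<in> hom_set (idem_cat T) g f" for a f g
      using that by (auto simp: S.hom_idem_cat T.hom_idem_cat \<phi>_idem simp flip: \<phi>_mult)
  qed (auto simp: T.hom_idem_cat \<phi>_idem \<phi>_mult)
  show "bij_betw ?Ga (hom_set (idem_cat T) g f) (hom_set (idem_cat S) (\<phi> g) (\<phi> f))"
    if "g \<in> obj (idem_cat T)" "f \<in> obj (idem_cat T)" for f g
  proof -
    have fg: "g \<in> idempotents T" "f \<in> idempotents T"
      using that by auto
    have "(\<phi> f, s, \<phi> g) \<in> ?Ga ` hom_set (idem_cat T) g f"
      if s: "s \<in> carrier S" "\<phi> f \<otimes>\<^bsub>S\<^esub> s = s" "s \<otimes>\<^bsub>S\<^esub> \<phi> g = s" for s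
    proof -
      \<comment> \<open>The idempotents \<open>\<phi> f\<close> and \<open>\<phi> g\<close> lie
        below \<open>e\<close>, so an element between them already belongs to eSe and \<psi>
        provides its preimage.\<close>
      have "e \<otimes>\<^bsub>S\<^esub> s = s" "s \<otimes>\<^bsub>S\<^esub> e = s"
        using s fg S.m_assoc[of e "\<phi> f" s] S.m_assoc[of s "\<phi> g" e] by auto
      with s have [simp]: "\<psi> s \<in> carrier T" "\<phi> (\<psi> s) = s" by auto
      have "f \<otimes>\<^bsub>T\<^esub> \<psi> s = \<psi> s" "\<psi> s \<otimes>\<^bsub>T\<^esub> g = \<psi> s"
        using s fg by (auto intro!: \<phi>_inj simp: \<phi>_mult)
      then show ?thesis
        using fg by (intro image_eqI[of _ _ "(f, \<psi> s, g)"]) (auto simp: T.hom_idem_cat)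
    qed
    then show ?thesis
      using fg by (auto simp: bij_betw_def inj_on_def S.hom_idem_cat T.hom_idem_cat \<phi>_idem
          dest: \<phi>_inj simp flip: \<phi>_mult)
  qed
  show "\<exists>x \<in> obj (idem_cat T). isomorphisms (idem_cat S) f (\<phi> x) \<noteq> {}"
    if "f \<in> obj (idem_cat S)" for f
  proof -
    have f: "f \<in> idempotents S"
      using that by simp
    then obtain x where x: "x \<in> carrier S" "x \<otimes>\<^bsub>S\<^esub> star S x = f" "x \<otimes>\<^bsub>S\<^esub> e = x"
      using S.full_idem_dominates[OF e full] by blast
    define g where "g = star S x \<otimes>\<^bsub>S\<^esub> x"
    have "e \<otimes>\<^bsub>S\<^esub> star S x = star S x"
      using x S.star_mult[of x e] by simp
    then have "e \<otimes>\<^bsub>S\<^esub> g = g" "g \<otimes>\<^bsub>S\<^esub> e = g"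
      using x S.m_assoc[of e "star S x" x] S.m_assoc[of "star S x" x e] by (auto simp: g_def)
    moreover have g: "g \<in> idempotents S"
      using x by (simp add: g_def)
    ultimately have \<psi>g: "\<psi> g \<in> carrier T" "\<phi> (\<psi> g) = g" by auto
    then have "\<psi> g \<in> idempotents T"
      using g by (intro T.idemI \<phi>_inj) (auto simp: \<phi>_mult)
    \<comment> \<open>The inverse arrow is given by \<open>x\<close> itself: the two composites are
      \<open>x \<otimes> star S x = f\<close> and \<open>star S x \<otimes> x = g\<close>.\<close>
    moreover have "(g, star S x, f) \<in> isomorphisms (idem_cat S) f g"
    proof -
      have "g \<otimes>\<^bsub>S\<^esub> star S x = star S x" "star S x \<otimes>\<^bsub>S\<^esub> f = star S x"
          "f \<otimes>\<^bsub>S\<^esub> x = x" "x \<otimes>\<^bsub>S\<^esub> g = x"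
        using x(1) by (auto simp: g_def S.m_assoc S.mult_star_mult S.star_mult_star simp flip: x(2))
      then have "(g, star S x, f) \<in> hom_set (idem_cat S) f g" "(f, x, g) \<in> hom_set (idem_cat S) g f"
        using x f g by (auto simp: S.hom_idem_cat)
      moreover have "arr_comp (idem_cat S) (f, x, g) (g, star S x, f) = ident (idem_cat S) f"
          "arr_comp (idem_cat S) (g, star S x, f) (f, x, g) = ident (idem_cat S) g"
        using x by (auto simp: g_def)
      ultimately show ?thesis unfolding isomorphisms_def by blast
    qed
    ultimately show ?thesis
      using \<psi>g by (intro bexI[of _ "\<psi> g"]) auto
  qed
qed

end

section \<open>From equivalent idempotent categories to a full corner\<close>

lemma equivalent_idem_cat_corner:
  fixes S :: "('a, 'm) monoid_scheme" and T :: "('b, 'n) monoid_scheme"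
  assumes "inverse_semigroup S" "inverse_semigroup T" "monoid T"
    and "equivalent_categories (idem_cat S) (idem_cat T)"
  shows "\<exists>e \<in> idempotents S.
    carrier S = carrier S <#>\<^bsub>S\<^esub> {e} <#>\<^bsub>S\<^esub> carrier S \<and> T \<cong> local_monoid S e"
proof -
  interpret S: inverse_semigroup S by fact
  interpret T: inverse_semigroup T by fact
  interpret T': monoid T by fact
  obtain Go Ga where "cat_functor (idem_cat T) (idem_cat S) Go Ga"
    and ff: "\<And>x y. \<lbrakk>x \<in> obj (idem_cat T); y \<in> obj (idem_cat T)\<rbrakk> \<Longrightarrow>
      bij_betw Ga (hom_set (idem_cat T) x y) (hom_set (idem_cat S) (Go x) (Go y))"
    and es: "\<And>z. z \<in> obj (idem_cat S) \<Longrightarrow> \<exists>x \<in> obj (idem_cat T). isomorphisms (idem_cat S) z (Go x) \<noteq> {}"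
    using equivalent_categories_fully_faithful[OF assms(4)] by blast
  interpret G: cat_functor "idem_cat T" "idem_cat S" Go Ga by fact
  let ?i = "\<one>\<^bsub>T\<^esub>"
  have i [simp]: "?i \<in> idempotents T" by (intro T.idemI) auto
  define e where "e = Go ?i"
  have e [simp]: "e \<in> idempotents S"
    using G.map_obj[of ?i] by (simp add: e_def)
  \<comment> \<open>The functor restricted to endomorphisms of the identity of \<open>T\<close>; an
    endomorphism is determined by its middle entry, and on that object these entries range over all
    of \<open>T\<close>.\<close>
  define \<phi> where "\<phi> t = fst (snd (Ga (?i, t, ?i)))" for t
  have end_T: "hom_set (idem_cat T) ?i ?i = (\<lambda>t. (?i, t, ?i)) ` carrier T"
    by (auto simp: T.hom_idem_cat)
  have end_S: "hom_set (idem_cat S) e e = (\<lambda>s. (e, s, e)) ` carrier (local_monoid S e)"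
    by (auto simp: S.hom_idem_cat S.carrier_local_monoid)
  have Ga: "Ga (?i, t, ?i) = (e, \<phi> t, e)" "\<phi> t \<in> carrier (local_monoid S e)" if "t \<in> carrier T" for t
    using G.map_hom[of "(?i, t, ?i)" ?i ?i] that
    by (auto simp: end_T end_S \<phi>_def simp flip: e_def)
  have bij: "bij_betw Ga (hom_set (idem_cat T) ?i ?i) (hom_set (idem_cat S) e e)"
    unfolding e_def by (rule ff) auto
  have "\<phi> \<in> iso T (local_monoid S e)"
    unfolding iso_iff
  proof (intro conjI)
    show "\<phi> \<in> hom T (local_monoid S e)"
    proof (rule homI)
      fix t u assume t: "t \<in> carrier T" and u: "u \<in> carrier T"
      have "Ga (arr_comp (idem_cat T) (?i, t, ?i) (?i, u, ?i))
          = arr_comp (idem_cat S) (Ga (?i, t, ?i)) (Ga (?i, u, ?i))"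
        by (rule G.map_compose) (use t u end_T in auto)
      then show "\<phi> (t \<otimes>\<^bsub>T\<^esub> u) = \<phi> t \<otimes>\<^bsub>local_monoid S e\<^esub> \<phi> u"
        using t u by (simp add: Ga local_monoid_def)
    qed (rule Ga)
    show "inj_on \<phi> (carrier T)"
      using bij Ga(1) by (auto simp: bij_betw_def inj_on_def end_T)
    have "s \<in> \<phi> ` carrier T" if "s \<in> carrier (local_monoid S e)" for s
    proof -
      have "(e, s, e) \<in> Ga ` hom_set (idem_cat T) ?i ?i"
        using that bij by (simp add: bij_betw_def end_S)
      then show ?thesis by (auto simp: end_T Ga)
    qed
    then show "\<phi> ` carrier T = carrier (local_monoid S e)"
      using Ga(2) by blast
  qed
  then have iso: "T \<cong> local_monoid S e"
    unfolding is_iso_def by blast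
  txt \<open>Every idempotent of \<open>T\<close> is a retract of \<open>\<one>\<close> in the category, so every idempotent of \<open>S\<close>
    is a retract of \<open>e\<close>, that is, a product passing through \<open>e\<close>.\<close>
  have "\<exists>a \<in> carrier S. \<exists>b \<in> carrier S. f = a \<otimes>\<^bsub>S\<^esub> (e \<otimes>\<^bsub>S\<^esub> b)" if f: "f \<in> idempotents S" for f
  proof -
    obtain h where h: "h \<in> idempotents T" and iso_h: "isomorphisms (idem_cat S) f (Go h) \<noteq> {}"
      using es[of f] f by auto
    obtain s s' where s: "s \<in> carrier S" "s' \<in> carrier S" "s' \<otimes>\<^bsub>S\<^esub> s = f" "Go h \<otimes>\<^bsub>S\<^esub> s = s"
      using iso_h by (auto simp: isomorphisms_def S.hom_idem_cat)
    have h_hom: "(?i, h, h) \<in> hom_set (idem_cat T) h ?i" "(h, h, ?i) \<in> hom_set (idem_cat T) ?i h"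
      using h by (auto simp: T.hom_idem_cat)
    obtain p where p: "p \<in> carrier S" "Ga (?i, h, h) = (e, p, Go h)"
      using G.map_hom[OF h_hom(1)] by (auto simp: S.hom_idem_cat e_def)
    obtain q where q: "q \<in> carrier S" "Ga (h, h, ?i) = (Go h, q, e)" "q \<otimes>\<^bsub>S\<^esub> e = q"
      using G.map_hom[OF h_hom(2)] by (auto simp: S.hom_idem_cat e_def)
    have "arr_comp (idem_cat T) (h, h, ?i) (?i, h, h) = ident (idem_cat T) h"
      using h by simp
    then have qp: "q \<otimes>\<^bsub>S\<^esub> p = Go h"
      using G.map_compose[OF h_hom(2,1)] G.map_ident[of h] h p q by simp
    \<comment> \<open>The identity at \<open>f\<close> runs along \<open>s\<close> to
      \<open>Go h\<close>, along \<open>p\<close> to \<open>e\<close>, along \<open>q\<close> back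
      to \<open>Go h\<close>, and along \<open>s'\<close> back to \<open>f\<close>; \<open>e\<close>
      can be inserted after \<open>q\<close>.\<close>
    have "f = s' \<otimes>\<^bsub>S\<^esub> (q \<otimes>\<^bsub>S\<^esub> p \<otimes>\<^bsub>S\<^esub> s)"
      using s by (simp add: qp)
    also have "\<dots> = s' \<otimes>\<^bsub>S\<^esub> (q \<otimes>\<^bsub>S\<^esub> e \<otimes>\<^bsub>S\<^esub> p \<otimes>\<^bsub>S\<^esub> s)"
      using q by simp
    also have "\<dots> = (s' \<otimes>\<^bsub>S\<^esub> q) \<otimes>\<^bsub>S\<^esub> (e \<otimes>\<^bsub>S\<^esub> (p \<otimes>\<^bsub>S\<^esub> s))"
      using s p(1) q(1) by (simp add: S.m_assoc)
    finally show ?thesis using s p q by blast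
  qed
  then have "carrier S = carrier S <#>\<^bsub>S\<^esub> {e} <#>\<^bsub>S\<^esub> carrier S"
    by (simp add: S.full_iff_idem)
  with e iso show ?thesis by blast
qed

section \<open>Equivalence of the three conditions, enlargements, and the case of two
  monoids\<close>

theorem corollary5p5:
  fixes S :: "('a, 'm) monoid_scheme" and T :: "('b, 'n) monoid_scheme"
  assumes "inverse_semigroup S" and "inverse_semigroup T" and "monoid T"
  shows "((\<exists>e \<in> idempotents S.
             carrier S = carrier S <#>\<^bsub>S\<^esub> {e} <#>\<^bsub>S\<^esub> carrier S \<and> T \<cong> local_monoid S e)
            \<longleftrightarrow> strongly_morita_equivalent S T)
       \<and> (strongly_morita_equivalent S T
            \<longleftrightarrow> equivalent_categories (idem_cat S) (idem_cat T))
       \<and> (strongly_morita_equivalent S T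
            \<longrightarrow> (\<exists>U. enlargement S U \<and> T \<cong> S\<lparr>carrier := U\<rparr>))
       \<and> (monoid S
            \<longrightarrow> (strongly_morita_equivalent S T
                 \<longleftrightarrow> (\<exists>e \<in> idempotents S. \<exists>f \<in> idempotents T.
                        carrier S = carrier S <#>\<^bsub>S\<^esub> {e} <#>\<^bsub>S\<^esub> carrier S \<and>
                        local_monoid S e \<cong> T \<and>
                        carrier T = carrier T <#>\<^bsub>T\<^esub> {f} <#>\<^bsub>T\<^esub> carrier T \<and>
                        local_monoid T f \<cong> S)))"
proof -
  interpret S: inverse_semigroup S by fact
  interpret T: inverse_semigroup T by fact
  have morita: "strongly_morita_equivalent S T"
    and cat: "equivalent_categories (idem_cat S) (idem_cat T)"
    if "e \<in> idempotents S" "carrier S = carrier S <#>\<^bsub>S\<^esub> {e} <#>\<^bsub>S\<^esub> carrier S" "T \<cong> local_monoid S e" for e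
  proof -
    obtain \<phi> where "\<phi> \<in> iso T (local_monoid S e)"
      using \<open>T \<cong> local_monoid S e\<close> by (auto simp: is_iso_def)
    then interpret full_corner S T e \<phi>
      using that by unfold_locales
    show "strongly_morita_equivalent S T"
      by (rule strongly_morita_equivalentI[OF morita_context_corner])
    show "equivalent_categories (idem_cat S) (idem_cat T)"
      by (rule equivalent_categories_corner)
  qed
  have enl: "\<exists>U. enlargement S U \<and> T \<cong> S\<lparr>carrier := U\<rparr>" if st: "strongly_morita_equivalent S T"
  proof -
    obtain e where e: "e \<in> idempotents S" "carrier S = carrier S <#>\<^bsub>S\<^esub> {e} <#>\<^bsub>S\<^esub> carrier S"
        "T \<cong> local_monoid S e"
      using strongly_morita_equivalent_corner[OF st assms(3)] by blast
    \<comment> \<open>The two structures on eSe differ only in the field \<open>one\<close>, which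
      isomorphisms ignore.\<close>
    have "T \<cong> S\<lparr>carrier := carrier (local_monoid S e)\<rparr>"
      using e(3) by (auto simp: is_iso_def iso_def hom_def local_monoid_def)
    with S.enlargement_local_monoid[OF e(1,2)] show ?thesis by blast
  qed
  have mon: "strongly_morita_equivalent S T \<longleftrightarrow> (\<exists>e \<in> idempotents S. \<exists>f \<in> idempotents T.
      carrier S = carrier S <#>\<^bsub>S\<^esub> {e} <#>\<^bsub>S\<^esub> carrier S \<and> local_monoid S e \<cong> T \<and>
      carrier T = carrier T <#>\<^bsub>T\<^esub> {f} <#>\<^bsub>T\<^esub> carrier T \<and> local_monoid T f \<cong> S)" (is "_ \<longleftrightarrow> ?R")
    if "monoid S"
  proof
    assume st: "strongly_morita_equivalent S T"
    obtain e where e: "e \<in> idempotents S" "carrier S = carrier S <#>\<^bsub>S\<^esub> {e} <#>\<^bsub>S\<^esub> carrier S"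
        "T \<cong> local_monoid S e"
      using strongly_morita_equivalent_corner[OF st assms(3)] by blast
    \<comment> \<open>By symmetry the roles are exchanged, with \<open>S\<close> now supplying the
      identity element.\<close>
    obtain f where f: "f \<in> idempotents T" "carrier T = carrier T <#>\<^bsub>T\<^esub> {f} <#>\<^bsub>T\<^esub> carrier T"
        "S \<cong> local_monoid T f"
      using strongly_morita_equivalent_corner[OF strongly_morita_equivalent_sym[OF st] \<open>monoid S\<close>]
      by blast
    show ?R
      using e f is_iso_sym[OF S.m_closed f(3)] is_iso_sym[OF T.m_closed e(3)] by blast
  next
    assume ?R
    then obtain e where e: "e \<in> idempotents S" "carrier S = carrier S <#>\<^bsub>S\<^esub> {e} <#>\<^bsub>S\<^esub> carrier S"
        "local_monoid S e \<cong> T"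
      by blast
    \<comment> \<open>Reversing the isomorphism at \<open>e\<close> gives the corner condition from
      which \<open>morita\<close> builds the context.\<close>
    have "T \<cong> local_monoid S e"
      using S.local_monoid_closed[OF e(1)] e(3) by (rule is_iso_sym)
    with e show "strongly_morita_equivalent S T" by (blast intro: morita)
  qed
  show ?thesis
    using strongly_morita_equivalent_corner[OF _ assms(3)] morita cat enl mon
      equivalent_idem_cat_corner[OF assms] by blast
qed

end
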